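(* Let $P\subseteq\mathbb{R}^d$ be a rational $d$-polytope with codenominator $r$, and let $\lambda\in\mathbb{R}_{\ge0}$. Then $$\operatorname{ehr}_{\mathbb{R}}(P;\lambda)=\begin{cases}\operatorname{ehr}_{\mathbb{Q}}(P;\lambda)&\text{if }\lambda\in\frac1r\mathbb{Z}_{\ge0},\\ \operatorname{ehr}_{\mathbb{Q}}(P;\lfloor\lambda\rceil)&\text{if }\lambda\notin\frac1r\mathbb{Z}_{\ge0},\end{cases}$$ where $\lfloor\lambda\rceil:=\frac{2j+1}{2r}$ for the $j\in\mathbb{Z}$ with $\left|\lambda-\frac{2j+1}{2r}\right|<\frac1{2r}$. Furthermore, if $\mathbf{0}\in P$ then $$\operatorname{ehr}_{\mathbb{R}}(P;\lambda)=\operatorname{ehr}_{\mathbb{Q}}\left(P;\frac{\lfloor r\lambda\rfloor}{r}\right).$$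
   Context: A rational polytope is the convex hull of finitely many points of $\mathbb{Q}^d$; a $d$-polytope is a $d$-dimensional polytope in $\mathbb{R}^d$, $d\ge1$. Codenominator: write a rational $d$-polytope $P$ by its irredundant halfspace description $P=\{\mathbf{x}\in\mathbb{R}^d:\mathbf{A}\mathbf{x}\le\mathbf{b}\}$ with $\mathbf{A}\in\mathbb{Z}^{n\times d}$, $\mathbf{b}\in\mathbb{Z}^n$, such that for every $i$ the greatest common divisor of $b_i$ and the entries of the $i$th row of $\mathbf{A}$ is $1$; the codenominator of $P$ is the (positive) least common multiple $r$ of the nonzero entries of $\mathbf{b}$. The rational and real Ehrhart counting functions are both given by $|\lambda P\cap\mathbb{Z}^d|$: it is denoted $\operatorname{ehr}_{\mathbb{Q}}(P;\lambda)$ for rational $\lambda$ and $\operatorname{ehr}_{\mathbb{R}}(P;\lambda)$ for real $\lambda$. $\lfloor x\rfloor$ is the largest integer $\le x$. *)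

theory Defs
  imports "HOL-Analysis.Analysis"
begin

definition integer_points :: "(real ^ 'n) set" where
  "integer_points = {x. \<forall>i. x $ i \<in> \<int>}"

definition rational_points :: "(real ^ 'n) set" where
  "rational_points = {x. \<forall>i. x $ i \<in> \<rat>}"

definition rational_polytope :: "(real ^ 'n) set \<Rightarrow> bool" where
  "rational_polytope P \<longleftrightarrow>
     (\<exists>V. finite V \<and> V \<subseteq> rational_points \<and> P = convex hull V)"

text \<open>
  A system A x \<le> b with integer data is encoded as the set of its pairs
  (row of A, entry of b).  Nothing is lost by using a set: an irredundant system has no
  repeated rows.
\<close>

definition solution_set :: "((int ^ 'n) \<times> int) set \<Rightarrow> (real ^ 'n) set" where
  "solution_set H =
     {x. \<forall>(a, b) \<in> H. (\<chi> i. real_of_int (a $ i)) \<bullet> x \<le> real_of_int b}"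

definition irredundant_description ::
    "(real ^ 'n) set \<Rightarrow> ((int ^ 'n) \<times> int) set \<Rightarrow> bool" where
  "irredundant_description P H \<longleftrightarrow>
     finite H \<and> P = solution_set H \<and>
     (\<forall>h \<in> H. solution_set (H - {h}) \<noteq> P) \<and>
     (\<forall>(a, b) \<in> H. Gcd (insert b (range (\<lambda>i. a $ i))) = 1)"

text \<open>
  For a full-dimensional rational polytope there is exactly one such description: its
  inequalities are the primitive integer inequalities that define the facets.
\<close>

definition halfspace_description ::
    "(real ^ 'n) set \<Rightarrow> ((int ^ 'n) \<times> int) set" where
  "halfspace_description P = (THE H. irredundant_description P H)"

definition codenominator :: "(real ^ 'n) set \<Rightarrow> nat" where
  "codenominator P = nat (Lcm (snd ` halfspace_description P - {0}))"

definition ehr_real :: "(real ^ 'n) set \<Rightarrow> real \<Rightarrow> nat" where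
  "ehr_real P t = card ((\<lambda>x. t *\<^sub>R x) ` P \<inter> integer_points)"

definition ehr_rat :: "(real ^ 'n) set \<Rightarrow> rat \<Rightarrow> nat" where
  "ehr_rat P q = card ((\<lambda>x. real_of_rat q *\<^sub>R x) ` P \<inter> integer_points)"

text \<open>
  The midpoint of the open interval ]j/r, (j+1)/r[ that contains \<open>t\<close>; it is
  unspecified when \<open>t\<close> is an integer multiple of 1/r.
\<close>

definition round_mid :: "nat \<Rightarrow> real \<Rightarrow> rat" where
  "round_mid r t =
     (let j = (THE j :: int.
                 \<bar>t - real_of_int (2 * j + 1) / real (2 * r)\<bar> < 1 / real (2 * r))
      in of_int (2 * j + 1) / of_nat (2 * r))"

end

theory Submission imports Defs begin

text \<open>
  Write \<open>P = {x. A x \<le> b}\<close> with integer data.  For \<open>t \<ge> 0\<close> the dilate \<open>t P\<close> is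
  \<open>{x. A x \<le> t b}\<close> (\<open>dilate_solution_set\<close>).  At an integer point the left sides are integers, so
  an inequality \<open>m \<le> t b\<^sub>i\<close> can only change its truth value when \<open>t b\<^sub>i\<close> passes an integer,
  and since every nonzero \<open>b\<^sub>i\<close> divides \<open>r\<close> this only happens at multiples of \<open>1/r\<close>.  Hence the lattice
  points of \<open>t P\<close> are the same for all \<open>t\<close> in an open interval between consecutive multiples of
  \<open>1/r\<close>.  If \<open>0 \<in> P\<close>, then every \<open>b\<^sub>i\<close> is nonnegative, such an inequality only changes from
  false to true as \<open>t\<close> grows, and it does so at the left endpoint already; that endpoint may
  therefore be included (\<open>integer_inequality_cell\<close>).

  The codenominator is read off from \<^emph>\<open>the\<close> irredundant primitive description, so this argument
  needs that the description exists and is unique.  Both follow from the correspondence between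
  irredundant inequalities and facets.  A facet has dimension \<open>d - 1\<close>, so it determines its
  hyperplane; the side on which \<open>P\<close> lies fixes the sign of the equation, and primitivity its
  scale (\<open>irredundant_description_subset\<close>).  For existence, a minimal system of real halfspaces
  has to be rewritten with integer data.  A facet is the convex hull of rational vertices, and
  applying a \<open>\<rat>\<close>-linear functional \<open>\<real> \<rightarrow> \<rat>\<close> to all coefficients of the equation of its hyperplane
  gives a rational equation satisfied by the same vertices (\<open>rational_hyperplane\<close>).
\<close>

section \<open>Integer inequalities as halfspaces\<close>

abbreviation real_vec :: "int ^ 'n \<Rightarrow> real ^ 'n" where
  "real_vec a \<equiv> (\<chi> i. real_of_int (a $ i))"

definition halfspace :: "(int ^ 'n) \<times> int \<Rightarrow> (real ^ 'n) set" where
  "halfspace h = {x. real_vec (fst h) \<bullet> x \<le> real_of_int (snd h)}"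

definition primitive :: "(int ^ 'n) \<times> int \<Rightarrow> bool" where
  "primitive h \<longleftrightarrow> Gcd (insert (snd h) (range (\<lambda>i. fst h $ i))) = 1"

lemma solution_set_eq_Inter: "solution_set H = \<Inter> (halfspace ` H)"
  by (fastforce simp: solution_set_def halfspace_def)

lemma irredundant_description_alt:
  "irredundant_description P H \<longleftrightarrow>
     finite H \<and> P = solution_set H \<and> (\<forall>h \<in> H. solution_set (H - {h}) \<noteq> P) \<and> (\<forall>h \<in> H. primitive h)"
  unfolding irredundant_description_def primitive_def by (auto split: prod.splits)

lemma real_vec_eq_0_iff: "real_vec a = 0 \<longleftrightarrow> a = 0"
  by (simp add: vec_eq_iff)

section \<open>Rational hyperplanes\<close>

text \<open>
  As a vector space over \<open>\<rat>\<close>, the real line has a basis containing any given nonzero number.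
\<close>

lemma rational_functional:
  fixes c :: real
  assumes "c \<noteq> 0"
  obtains f :: "real \<Rightarrow> rat" where "f c = 1" "\<And>x y. f (x + y) = f x + f y"
    "\<And>q x. f (of_rat q * x) = q * f x"
proof -
  interpret R: vector_space "\<lambda>q x :: real. of_rat q * x"
    by unfold_locales (auto simp: algebra_simps of_rat_add of_rat_mult)
  interpret Q: vector_space "\<lambda>q x :: rat. q * x"
    by unfold_locales (auto simp: algebra_simps)
  interpret RQ: vector_space_pair "\<lambda>q x :: real. of_rat q * x" "\<lambda>q x :: rat. q * x" ..
  have ind: "R.independent {c}"
    using assms by simp
  let ?f = "RQ.construct {c} (\<lambda>_. 1)"
  have lin: "Vector_Spaces.linear (\<lambda>q x :: real. of_rat q * x) (\<lambda>q x :: rat. q * x) ?f"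
    by (rule RQ.linear_construct[OF ind])
  show thesis
  proof (rule that[of ?f])
    show "?f c = 1" by (rule RQ.construct_basis[OF ind]) simp
  qed (use lin in \<open>simp_all add: Vector_Spaces.linear_iff\<close>)
qed

lemma rational_functional_sum:
  fixes f :: "real \<Rightarrow> rat"
  assumes add: "\<And>x y. f (x + y) = f x + f y"
  shows "f (sum g A) = (\<Sum>i\<in>A. f (g i))"
proof -
  have "f 0 = 0" using add[of 0 0] by simp
  then show ?thesis
    by (induction A rule: infinite_finite_induct) (auto simp: add)
qed

text \<open>
  A \<open>\<rat>\<close>-linear functional \<open>f\<close> commutes with the rational combination \<open>a \<bullet> v\<close> of the coefficients
  \<open>a\<^sub>j\<close>, so the equation \<open>a \<bullet> v = b\<close> survives when \<open>f\<close> is applied to all of its coefficients.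
  Normalising \<open>f\<close> at a nonzero coefficient keeps the new normal vector nonzero.
\<close>

lemma rational_hyperplane:
  fixes V :: "(real ^ 'n) set"
  assumes V: "V \<subseteq> rational_points" and a: "a \<noteq> 0" "V \<subseteq> {x. a \<bullet> x = b}"
  obtains a' b' where "a' \<in> rational_points" "b' \<in> \<rat>" "a' \<noteq> 0" "V \<subseteq> {x. a' \<bullet> x = b'}"
proof -
  obtain i where i: "a $ i \<noteq> 0" using a(1) by (auto simp: vec_eq_iff)
  obtain f :: "real \<Rightarrow> rat" where f: "f (a $ i) = 1" "\<And>x y. f (x + y) = f x + f y"
    "\<And>q x. f (of_rat q * x) = q * f x"
    using rational_functional[OF i] by metis
  define a' :: "real ^ 'n" where "a' = (\<chi> j. of_rat (f (a $ j)))"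
  have "a' \<bullet> v = of_rat (f b)" if "v \<in> V" for v
  proof -
    have "\<forall>j. \<exists>q. v $ j = of_rat q"
      using that V by (auto simp: rational_points_def Rats_def)
    then obtain q where q: "\<And>j. v $ j = of_rat (q j)" by metis
    have "f b = f (\<Sum>j\<in>UNIV. of_rat (q j) * a $ j)"
      using a(2) that by (auto simp: inner_vec_def q mult.commute)
    also have "\<dots> = (\<Sum>j\<in>UNIV. q j * f (a $ j))"
      by (simp add: rational_functional_sum[of f, OF f(2)] f(3))
    finally show ?thesis
      by (simp add: a'_def inner_vec_def q of_rat_sum of_rat_mult mult.commute)
  qed
  moreover have "a' $ i \<noteq> 0" by (simp add: a'_def f(1))
  then have "a' \<noteq> 0" by auto
  moreover have "a' \<in> rational_points" by (simp add: a'_def rational_points_def)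
  ultimately show thesis using that[of a' "of_rat (f b)"] by auto
qed

text \<open>
  Both hyperplanes are the affine hull of \<open>C\<close>, so they coincide, and every vector orthogonal to
  \<open>a\<close> is orthogonal to \<open>a'\<close>.
\<close>

lemma proportional_if_contain_hyperplane:
  fixes C :: "'a :: euclidean_space set"
  assumes dim: "aff_dim C = int DIM('a) - 1" and ne: "C \<noteq> {}"
    and a: "a \<noteq> 0" "C \<subseteq> {x. a \<bullet> x = b}"
    and a': "a' \<noteq> 0" "C \<subseteq> {x. a' \<bullet> x = b'}"
  obtains k where "k \<noteq> 0" "a' = k *\<^sub>R a" "b' = k * b"
proof -
  have hull: "affine hull C = {x. u \<bullet> x = v}" if "u \<noteq> 0" "C \<subseteq> {x. u \<bullet> x = v}" for u v
  proof (rule affine_dim_equal)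
    show "affine hull C \<subseteq> {x. u \<bullet> x = v}"
      by (rule hull_minimal[of _ _ affine]) (use that in \<open>auto simp: affine_hyperplane\<close>)
  qed (use that dim ne in \<open>auto simp: affine_hyperplane\<close>)
  have eq: "{x. a \<bullet> x = b} = {x. a' \<bullet> x = b'}"
    using hull[OF a] hull[OF a'] by simp
  obtain x0 where "x0 \<in> C" using ne by auto
  with a a' have x0: "a \<bullet> x0 = b" "a' \<bullet> x0 = b'" by auto
  have orth: "a' \<bullet> y = 0" if "a \<bullet> y = 0" for y
  proof -
    have "x0 + y \<in> {x. a \<bullet> x = b}" using that x0 by (simp add: inner_add_right)
    then show ?thesis using eq x0 by (simp add: inner_add_right)
  qed
  \<comment> \<open>The part of \<open>a'\<close> orthogonal to \<open>a\<close> is orthogonal to \<open>a'\<close> and hence to itself.\<close>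
  define k where "k = (a \<bullet> a') / (a \<bullet> a)"
  define y where "y = a' - k *\<^sub>R a"
  have ay: "a \<bullet> y = 0"
    using a(1) by (simp add: y_def k_def inner_diff_right)
  have "y \<bullet> y = 0"
    using orth[OF ay] ay by (simp add: y_def inner_diff_left inner_commute)
  then have k: "a' = k *\<^sub>R a" by (simp add: y_def)
  moreover have "k \<noteq> 0" using k a'(1) by auto
  moreover have "b' = k * b" using x0 k by auto
  ultimately show thesis using that by blast
qed

section \<open>Primitive integer inequalities\<close>

lemma common_denominator:
  fixes S :: "real set"
  assumes "finite S" "S \<subseteq> \<rat>"
  obtains D :: int where "D > 0" "\<And>x. x \<in> S \<Longrightarrow> of_int D * x \<in> \<int>"
proof -
  have "\<exists>D :: int. D > 0 \<and> (\<forall>x\<in>S. of_int D * x \<in> \<int>)"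
    using assms
  proof (induction S)
    case empty
    show ?case by (auto intro: exI[of _ 1])
  next
    case (insert x S)
    then obtain D :: int where D: "D > 0" "\<forall>x\<in>S. of_int D * x \<in> \<int>" by auto
    obtain m n :: int where mn: "n > 0" "x = of_int m / of_int n"
      using insert.prems by (auto elim: Rats_cases')
    have "of_int (D * n) * y \<in> \<int>" if "y \<in> insert x S" for y
    proof (cases "y = x")
      case True
      then show ?thesis using mn by simp
    next
      case False
      then have "of_int n * (of_int D * y) \<in> \<int>" using that D by auto
      then show ?thesis by (simp add: mult_ac)
    qed
    then show ?case using D mn by (intro exI[of _ "D * n"]) auto
  qed
  then show thesis using that by auto
qed

lemma primitive_multiple_exists:
  fixes a :: "real ^ 'n" and b :: real
  assumes "a \<in> rational_points" "b \<in> \<rat>" "a \<noteq> 0"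
  obtains k h where "k > 0" "primitive h" "real_vec (fst h) = k *\<^sub>R a" "of_int (snd h) = k * b"
proof -
  obtain D :: int where D: "D > 0" "\<And>x. x \<in> insert b (range (\<lambda>i. a $ i)) \<Longrightarrow> of_int D * x \<in> \<int>"
    using common_denominator[of "insert b (range (\<lambda>i. a $ i))"] assms
    by (auto simp: rational_points_def)
  define A where "A i = \<lfloor>D * a $ i\<rfloor>" for i
  define B where "B = \<lfloor>D * b\<rfloor>"
  have A: "of_int (A i) = D * a $ i" for i
    unfolding A_def using D(2)[of "a $ i"] by simp
  have B: "of_int B = D * b"
    unfolding B_def using D(2)[of b] by simp
  define g where "g = Gcd (insert B (range A))"
  obtain i where "a $ i \<noteq> 0" using assms(3) by (auto simp: vec_eq_iff)
  then have "A i \<noteq> 0" using A[of i] D(1) by auto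
  then have "g \<noteq> 0" unfolding g_def by auto
  moreover have "g \<ge> 0" unfolding g_def by simp
  ultimately have g: "g > 0" by simp
  have dvd: "g dvd A i" "g dvd B" for i unfolding g_def by (rule Gcd_dvd; simp)+
  define h :: "(int ^ 'n) \<times> int" where "h = ((\<chi> i. A i div g), B div g)"
  have "(*) g ` insert (snd h) (range (\<lambda>i. fst h $ i)) = insert B (range A)"
    using dvd by (auto simp: h_def image_image)
  then have "g = g * Gcd (insert (snd h) (range (\<lambda>i. fst h $ i)))"
    using Gcd_mult[of g "insert (snd h) (range (\<lambda>i. fst h $ i))"] g
    by (simp add: g_def abs_mult)
  then have "primitive h" using g by (simp add: primitive_def)
  moreover have "real_vec (fst h) = (D / g) *\<^sub>R a"
    using dvd A g by (simp add: vec_eq_iff h_def real_of_int_div)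
  moreover have "of_int (snd h) = (D / g) * b"
    using dvd B g by (simp add: h_def real_of_int_div)
  ultimately show thesis using that[of "D / g" h] D(1) g by simp
qed

text \<open>
  Comparing a nonzero coefficient shows that the factor \<open>k\<close> is a quotient \<open>n / m\<close> of positive
  integers, so \<open>m h' = n h\<close>.  Taking greatest common divisors of the entries gives \<open>m = n\<close>.
\<close>

lemma primitive_eq_if_positive_multiple:
  assumes prim: "primitive h" "primitive h'" and k: "k > 0" "fst h \<noteq> 0"
    and eq: "real_vec (fst h') = k *\<^sub>R real_vec (fst h)" "of_int (snd h') = k * of_int (snd h)"
  shows "h = h'"
proof -
  obtain i where i: "fst h $ i \<noteq> 0" using k(2) by (auto simp: vec_eq_iff)
  have fst_eq: "of_int (fst h' $ j) = k * of_int (fst h $ j)" for j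
    using eq(1) by (simp add: vec_eq_iff)
  define m n where "m = \<bar>fst h $ i\<bar>" and "n = \<bar>fst h' $ i\<bar>"
  have "m > 0" using i by (simp add: m_def)
  have n: "of_int n = k * of_int m"
    using k(1) by (simp add: m_def n_def fst_eq abs_mult)
  have "of_int (m * fst h' $ j) = (of_int (n * fst h $ j) :: real)" for j
    by (simp add: n fst_eq)
  then have 1: "m * fst h' $ j = n * fst h $ j" for j
    using of_int_eq_iff by blast
  have "of_int (m * snd h') = (of_int (n * snd h) :: real)"
    by (simp add: n eq(2))
  then have 2: "m * snd h' = n * snd h" using of_int_eq_iff by blast
  have "(*) m ` insert (snd h') (range (\<lambda>i. fst h' $ i)) = (*) n ` insert (snd h) (range (\<lambda>i. fst h $ i))"
    by (simp add: image_image 1 2)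
  then have "normalize (m * 1) = normalize (n * 1)"
    using Gcd_mult[of m "insert (snd h') (range (\<lambda>i. fst h' $ i))"]
      Gcd_mult[of n "insert (snd h) (range (\<lambda>i. fst h $ i))"] prim
    unfolding primitive_def by metis
  then have "m = n" by (simp add: m_def n_def)
  then show ?thesis using 1 2 \<open>m > 0\<close> by (simp add: prod_eq_iff vec_eq_iff)
qed

section \<open>Facets and the irredundant description\<close>

text \<open>
  A zero row defines the whole space or the empty set; the former is redundant, the latter
  would make \<open>P\<close> empty.
\<close>

lemma irredundant_row_nonzero:
  assumes "irredundant_description P H" "P \<noteq> {}" "h \<in> H"
  shows "fst h \<noteq> 0"
proof
  assume "fst h = 0"
  then have "real_vec (fst h) = 0" by (simp add: vec_eq_iff)
  then have "halfspace h = UNIV \<or> halfspace h = {}"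
    unfolding halfspace_def by auto
  moreover have "P \<subseteq> halfspace h"
    using assms by (auto simp: irredundant_description_alt solution_set_eq_Inter)
  ultimately have "halfspace h = UNIV" using assms(2) by auto
  then have "solution_set (H - {h}) = solution_set H"
    unfolding solution_set_eq_Inter by auto
  then show False using assms by (auto simp: irredundant_description_alt)
qed

text \<open>
  Full dimension makes the affine hull trivial, and irredundancy in the sense of dropping single
  rows implies minimality among all subfamilies of halfspaces, as the facet criterion for
  polyhedra requires.
\<close>

lemma irredundant_facets:
  fixes P :: "(real ^ 'n) set"
  assumes irr: "irredundant_description P H" and dim: "aff_dim P = int CARD('n)"
  shows "C facet_of P \<longleftrightarrow> (\<exists>h\<in>H. C = P \<inter> {x. real_vec (fst h) \<bullet> x = of_int (snd h)})"
proof -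
  have "P \<noteq> {}" using dim by auto
  have fin: "finite H" and P: "P = \<Inter> (halfspace ` H)"
    and red: "\<And>h. h \<in> H \<Longrightarrow> \<Inter> (halfspace ` (H - {h})) \<noteq> P"
    using irr by (auto simp: irredundant_description_alt solution_set_eq_Inter)
  have hull: "affine hull P = UNIV" using dim aff_dim_eq_full[of P] by simp
  \<comment> \<open>Two rows with the same halfspace would make each other redundant.\<close>
  have inj: "inj_on halfspace H"
  proof (rule inj_onI, rule ccontr)
    fix h h' assume *: "h \<in> H" "h' \<in> H" "halfspace h = halfspace h'" "h \<noteq> h'"
    then have "halfspace ` (H - {h}) = halfspace ` H" by auto
    then show False using red[OF *(1)] P by simp
  qed
  \<comment> \<open>The facet criterion wants coefficients as a function of the halfspace; injectivity provides it.\<close>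
  let ?i = "inv_into H halfspace"
  have "C facet_of P \<longleftrightarrow>
    (\<exists>h. h \<in> halfspace ` H \<and> C = P \<inter> {x. real_vec (fst (?i h)) \<bullet> x = of_int (snd (?i h))})"
  proof (rule facet_of_polyhedron_explicit)
    show "finite (halfspace ` H)" using fin by simp
    show "P = affine hull P \<inter> \<Inter> (halfspace ` H)" using hull P by simp
    show "real_vec (fst (?i h)) \<noteq> 0 \<and> h = {x. real_vec (fst (?i h)) \<bullet> x \<le> of_int (snd (?i h))}"
      if h: "h \<in> halfspace ` H" for h
    proof -
      obtain g where "g \<in> H" "h = halfspace g" using h by blast
      moreover from this have "?i h = g" using inj by simp
      ultimately show ?thesis
        using irredundant_row_nonzero[OF irr \<open>P \<noteq> {}\<close>, of g]
        by (simp only: real_vec_eq_0_iff halfspace_def) simp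
    qed
    show "P \<subset> affine hull P \<inter> \<Inter> F'" if F': "F' \<subset> halfspace ` H" for F'
    proof -
      obtain h where h: "h \<in> H" "halfspace h \<notin> F'" using F' by auto
      then have "F' \<subseteq> halfspace ` (H - {h})" using F' by auto
      then have "\<Inter> (halfspace ` (H - {h})) \<subseteq> \<Inter> F'" by auto
      moreover have "P \<subset> \<Inter> (halfspace ` (H - {h}))"
        using red[OF h(1)] P by auto
      ultimately show ?thesis using hull by auto
    qed
  qed
  also have "\<dots> \<longleftrightarrow> (\<exists>h\<in>H. C = P \<inter> {x. real_vec (fst h) \<bullet> x = of_int (snd h)})"
    using inj by auto
  finally show ?thesis .
qed

text \<open>
  A negative factor would put \<open>P\<close> on both sides of the hyperplane, hence inside it.
\<close>

lemma positive_factor_if_common_side: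
  fixes P :: "'a :: euclidean_space set"
  assumes dim: "aff_dim P = int DIM('a)" and a: "a \<noteq> 0"
    and sub: "P \<subseteq> {x. a \<bullet> x \<le> b}" "P \<subseteq> {x. (k *\<^sub>R a) \<bullet> x \<le> k * b}" and "k \<noteq> 0"
  shows "k > 0"
proof (rule ccontr)
  assume "\<not> k > 0"
  then have "k < 0" using \<open>k \<noteq> 0\<close> by simp
  then have "P \<subseteq> {x. a \<bullet> x = b}" using sub by (fastforce simp: mult_le_cancel_left)
  then have "aff_dim P \<le> aff_dim {x. a \<bullet> x = b}" by (rule aff_dim_subset)
  then show False using dim a by simp
qed

text \<open>
  This gives uniqueness by symmetry: the facet cut out by a row of \<open>H\<close> is also cut out by some
  row of \<open>H'\<close>, the two rows are proportional because the facet spans the hyperplane, and the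
  factor is \<open>1\<close> by positivity and primitivity.
\<close>

lemma irredundant_description_subset:
  fixes P :: "(real ^ 'n) set"
  assumes H: "irredundant_description P H" and H': "irredundant_description P H'"
    and dim: "aff_dim P = int CARD('n)"
  shows "H \<subseteq> H'"
proof
  fix h assume h: "h \<in> H"
  have ne: "P \<noteq> {}" using dim by auto
  let ?C = "P \<inter> {x. real_vec (fst h) \<bullet> x = of_int (snd h)}"
  have facet: "?C facet_of P" using irredundant_facets[OF H dim] h by blast
  then obtain h' where h': "h' \<in> H'" "?C = P \<inter> {x. real_vec (fst h') \<bullet> x = of_int (snd h')}"
    using irredundant_facets[OF H' dim] by blast
  have nz: "fst h \<noteq> 0" "fst h' \<noteq> 0"
    using irredundant_row_nonzero[OF H ne h] irredundant_row_nonzero[OF H' ne h'(1)] by auto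
  obtain k where k: "k \<noteq> 0" "real_vec (fst h') = k *\<^sub>R real_vec (fst h)" "of_int (snd h') = k * of_int (snd h)"
  proof (rule proportional_if_contain_hyperplane[of ?C "real_vec (fst h)" "of_int (snd h)"
        "real_vec (fst h')" "of_int (snd h')"])
    show "aff_dim ?C = int DIM(real ^ 'n) - 1" "?C \<noteq> {}"
      using facet dim by (auto simp: facet_of_def)
  qed (use nz h'(2) in \<open>auto simp: real_vec_eq_0_iff\<close>)
  have "P \<subseteq> halfspace h" "P \<subseteq> halfspace h'"
    using H H' h h'(1) by (auto simp: irredundant_description_alt solution_set_eq_Inter)
  then have sides: "P \<subseteq> {x. real_vec (fst h) \<bullet> x \<le> of_int (snd h)}"
      "P \<subseteq> {x. (k *\<^sub>R real_vec (fst h)) \<bullet> x \<le> k * of_int (snd h)}"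
    unfolding halfspace_def k(2,3) .
  have "real_vec (fst h) \<noteq> 0" using nz(1) by (simp only: real_vec_eq_0_iff not_False_eq_True)
  then have "k > 0"
    using positive_factor_if_common_side[OF _ _ sides k(1)] dim by simp
  moreover have "primitive h" "primitive h'"
    using H H' h h'(1) by (auto simp: irredundant_description_alt)
  ultimately have "h = h'"
    using primitive_eq_if_positive_multiple[of h h' k] k nz by blast
  then show "h \<in> H'" using h' by simp
qed

text \<open>
  The vertices of the facet are among the rational points spanning \<open>P\<close>, so its hyperplane has a
  rational equation.  That equation is a real multiple of the given one, possibly negative; after
  correcting the sign and clearing denominators it describes the same halfspace.
\<close>

lemma facet_halfspace_primitive:
  fixes P :: "(real ^ 'n) set"
  assumes rat: "rational_polytope P" and dim: "aff_dim P = int CARD('n)"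
    and a: "a \<noteq> 0" and facet: "(P \<inter> {x. a \<bullet> x = b}) facet_of P"
  obtains h where "primitive h" "halfspace h = {x. a \<bullet> x \<le> b}"
proof -
  let ?C = "P \<inter> {x. a \<bullet> x = b}"
  obtain V where V: "finite V" "V \<subseteq> rational_points" "P = convex hull V"
    using rat by (auto simp: rational_polytope_def)
  obtain W where W: "W \<subseteq> V" "?C = convex hull W"
    using face_of_convex_hull_subset[of V ?C] facet V
    by (auto simp: facet_of_def finite_imp_compact)
  have WC: "W \<subseteq> ?C" using W(2) hull_subset[of W convex] by simp
  obtain a' b' where a': "a' \<in> rational_points" "b' \<in> \<rat>" "a' \<noteq> 0" "W \<subseteq> {x. a' \<bullet> x = b'}"
    using rational_hyperplane[of W a b] W V WC a by blast
  have "?C \<subseteq> {x. a' \<bullet> x = b'}"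
    unfolding W(2) using a'(4) by (rule hull_minimal) (rule convex_hyperplane)
  then obtain k where k: "k \<noteq> 0" "a' = k *\<^sub>R a" "b' = k * b"
    using proportional_if_contain_hyperplane[of ?C a b a' b'] facet dim a a'
    by (auto simp: facet_of_def)
  define s where "s = sgn k"
  have s: "s * k > 0" "s \<in> \<rat>" using k(1) by (auto simp: s_def sgn_if)
  have sa': "s *\<^sub>R a' \<in> rational_points" "s * b' \<in> \<rat>" "s *\<^sub>R a' \<noteq> 0"
    using a' s by (auto simp: rational_points_def)
  then obtain c h where h: "c > 0" "primitive h" "real_vec (fst h) = c *\<^sub>R (s *\<^sub>R a')"
    "of_int (snd h) = c * (s * b')"
    using primitive_multiple_exists by blast
  have pos: "c * (s * k) > 0" using h(1) s(1) by simp
  have "halfspace h = {x. (c * (s * k)) * (a \<bullet> x) \<le> (c * (s * k)) * b}"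
    unfolding halfspace_def h k by (simp add: mult_ac)
  also have "\<dots> = {x. a \<bullet> x \<le> b}" using mult_le_cancel_left_pos[OF pos] by simp
  finally show thesis using that h(2) by blast
qed

text \<open>
  Each halfspace of a minimal real system cuts out a facet and so has a primitive integer form;
  replacing the halfspaces one by one keeps the system minimal.
\<close>

lemma irredundant_description_exists:
  fixes P :: "(real ^ 'n) set"
  assumes rat: "rational_polytope P" and dim: "aff_dim P = int CARD('n)"
  shows "\<exists>H. irredundant_description P H"
proof -
  have hull: "affine hull P = UNIV" using dim aff_dim_eq_full[of P] by simp
  have "polyhedron P"
    using rat by (auto simp: rational_polytope_def polytope_def intro!: polytope_imp_polyhedron)
  then obtain F where "finite F \<and> P = affine hull P \<inter> \<Inter> F \<and>
      (\<forall>h\<in>F. \<exists>a b. a \<noteq> 0 \<and> h = {x. a \<bullet> x \<le> b}) \<and>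
      (\<forall>F'. F' \<subset> F \<longrightarrow> P \<subset> affine hull P \<inter> \<Inter> F')"
    unfolding polyhedron_Int_affine_minimal ..
  then have F: "finite F" "P = affine hull P \<inter> \<Inter> F"
    "\<And>h. h \<in> F \<Longrightarrow> \<exists>a b. a \<noteq> 0 \<and> h = {x. a \<bullet> x \<le> b}"
    "\<And>F'. F' \<subset> F \<Longrightarrow> P \<subset> affine hull P \<inter> \<Inter> F'"
    by meson+
  have P: "P = \<Inter> F" using F(2) unfolding hull by simp
  obtain a b where ab: "\<And>h. h \<in> F \<Longrightarrow> a h \<noteq> 0 \<and> h = {x. a h \<bullet> x \<le> b h}"
    using F(3) by metis
  have "\<exists>g. primitive g \<and> halfspace g = h" if h: "h \<in> F" for h
  proof -
    have "(P \<inter> {x. a h \<bullet> x = b h}) facet_of P"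
      by (rule facet_of_polyhedron_explicit[OF F(1,2) ab F(4), THEN iffD2]) (use h in auto)
    then obtain g where g: "primitive g" "halfspace g = {x. a h \<bullet> x \<le> b h}"
      using facet_halfspace_primitive[OF rat dim, of "a h" "b h"] conjunct1[OF ab[OF h]] by blast
    have "halfspace g = h" using trans[OF g(2) sym[OF conjunct2[OF ab[OF h]]]] .
    then show ?thesis using g(1) by blast
  qed
  then obtain g where g: "\<And>h. h \<in> F \<Longrightarrow> primitive (g h) \<and> halfspace (g h) = h" by metis
  have "irredundant_description P (g ` F)"
    unfolding irredundant_description_alt solution_set_eq_Inter
  proof (intro conjI ballI)
    show "finite (g ` F)" using F(1) by simp
    show "P = \<Inter> (halfspace ` g ` F)" using P g by (simp add: image_image)
    show "primitive h" if "h \<in> g ` F" for h using that g by auto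
    show "\<Inter> (halfspace ` (g ` F - {h})) \<noteq> P" if h: "h \<in> g ` F" for h
    proof -
      obtain f where f: "f \<in> F" "h = g f" using h by blast
      have "inj_on g F" using g by (metis inj_onI)
      then have "g ` F - {h} = g ` (F - {f})"
        unfolding f(2) using f(1) by (simp add: inj_on_image_set_diff)
      then have "halfspace ` (g ` F - {h}) = F - {f}" using g by (simp add: image_image)
      moreover have "P \<subset> \<Inter> (F - {f})"
      proof -
        have "F - {f} \<subset> F" using f(1) by blast
        from F(4)[OF this] show ?thesis unfolding hull Int_UNIV_left .
      qed
      ultimately show ?thesis by (metis psubset_eq)
    qed
  qed
  then show ?thesis by blast
qed

text \<open>
  By existence and uniqueness the definite description \<open>halfspace_description\<close> denotes the
  intended system.
\<close>

lemma halfspace_description_irredundant: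
  fixes P :: "(real ^ 'n) set"
  assumes "rational_polytope P" "aff_dim P = int CARD('n)"
  shows "irredundant_description P (halfspace_description P)"
proof -
  obtain H where H: "irredundant_description P H"
    using irredundant_description_exists[OF assms] by blast
  show ?thesis
    unfolding halfspace_description_def
  proof (rule theI[of _ H])
    show "H' = H" if "irredundant_description P H'" for H'
      using irredundant_description_subset[OF that H] irredundant_description_subset[OF H that] assms(2)
      by blast
  qed (rule H)
qed

section \<open>Dilates of a polytope\<close>

lemma bounded_recession_direction_zero:
  fixes P :: "'a :: real_normed_vector set"
  assumes "bounded P" and ray: "\<And>k. k \<ge> 0 \<Longrightarrow> p + k *\<^sub>R x \<in> P"
  shows "x = 0"
proof (rule ccontr)
  assume "x \<noteq> 0"
  obtain B where B: "\<And>y. y \<in> P \<Longrightarrow> norm y \<le> B" using assms(1) by (auto simp: bounded_iff)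
  have "B \<ge> 0" using B[OF ray[of 0]] norm_ge_zero order_trans by blast
  define k where "k = (B + norm p + 1) / norm x"
  have "k \<ge> 0" using \<open>B \<ge> 0\<close> by (simp add: k_def)
  have "norm (k *\<^sub>R x) = B + norm p + 1" using \<open>x \<noteq> 0\<close> \<open>B \<ge> 0\<close> by (simp add: k_def)
  moreover have "norm (k *\<^sub>R x) \<le> norm (p + k *\<^sub>R x) + norm p"
    by (metis add_diff_cancel_left' norm_triangle_ineq4)
  ultimately show False using B[OF ray[OF \<open>k \<ge> 0\<close>]] by simp
qed

text \<open>
  For \<open>q > 0\<close> this is rescaling.  For \<open>q = 0\<close> the right side is the recession cone of the solution
  set, which is \<open>{0}\<close> for a nonempty bounded set and so equals the degenerate dilate.
\<close>

lemma dilate_solution_set: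
  fixes H :: "((int ^ 'n) \<times> int) set"
  assumes bdd: "bounded (solution_set H)" and ne: "solution_set H \<noteq> {}" and q: "q \<ge> 0"
  shows "(\<lambda>x. q *\<^sub>R x) ` solution_set H =
    {x. \<forall>(a, b) \<in> H. real_vec a \<bullet> x \<le> q * real_of_int b}"
proof (cases "q = 0")
  case True
  obtain p where p: "p \<in> solution_set H" using ne by auto
  have "x = 0" if "\<forall>(a, b) \<in> H. real_vec a \<bullet> x \<le> 0" for x
  proof (rule bounded_recession_direction_zero[OF bdd, of p])
    fix k :: real assume "k \<ge> 0"
    then have "real_vec a \<bullet> (k *\<^sub>R x) \<le> 0" if "(a, b) \<in> H" for a b
      using \<open>\<forall>(a, b) \<in> H. _\<close> that by (auto intro!: mult_nonneg_nonpos)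
    then show "p + k *\<^sub>R x \<in> solution_set H"
      using p unfolding solution_set_def by (fastforce simp: inner_add_right)
  qed
  then show ?thesis using True ne by auto
next
  case False
  with q have q: "q > 0" by simp
  have mem: "x \<in> (\<lambda>x. q *\<^sub>R x) ` solution_set H \<longleftrightarrow> (1 / q) *\<^sub>R x \<in> solution_set H" for x
    using q by (auto simp: image_iff intro!: bexI[of _ "(1 / q) *\<^sub>R x"])
  show ?thesis
  proof (rule set_eqI)
    fix x
    show "x \<in> (\<lambda>x. q *\<^sub>R x) ` solution_set H \<longleftrightarrow>
        x \<in> {x. \<forall>(a, b) \<in> H. real_vec a \<bullet> x \<le> q * real_of_int b}"
      unfolding mem using q by (simp add: solution_set_def divide_le_eq mult.commute)
  qed
qed

section \<open>Counting lattice points\<close>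

text \<open>
  Write \<open>r = b c\<close>.  For \<open>b > 0\<close> the inequality \<open>m \<le> t b\<close> becomes \<open>m c \<le> r t\<close>, a lower bound
  on \<open>r t\<close> by an integer, which depends on \<open>t\<close> only through \<open>\<lfloor>r t\<rfloor>\<close>.  For \<open>b < 0\<close> multiplying by
  \<open>c < 0\<close> turns it into an upper bound on \<open>r t\<close>, which depends on \<open>t\<close> only through
  \<open>\<lceil>r t\<rceil>\<close>.
\<close>

lemma integer_inequality_cell:
  fixes m b :: int and r :: nat and s t :: real
  assumes r: "r > 0" "b = 0 \<or> b dvd int r"
    and fl: "\<lfloor>r * s\<rfloor> = \<lfloor>r * t\<rfloor>" and ce: "b \<ge> 0 \<or> \<lceil>r * s\<rceil> = \<lceil>r * t\<rceil>"
  shows "m \<le> s * b \<longleftrightarrow> m \<le> t * b"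
proof (cases "b = 0")
  case False
  then obtain c where c: "int r = b * c" using r(2) by (auto simp: dvd_def)
  have rc: "real r = of_int b * of_int c" using c by (metis of_int_mult of_int_of_nat_eq)
  show ?thesis
  proof (cases "b > 0")
    case True
    then have "c > 0" using c r(1) by (metis of_nat_0_less_iff zero_less_mult_pos)
    have "m \<le> u * b \<longleftrightarrow> m * c \<le> \<lfloor>r * u\<rfloor>" for u :: real
    proof -
      have "m \<le> u * b \<longleftrightarrow> of_int c * m \<le> of_int c * (u * b)"
        using \<open>c > 0\<close> by simp
      also have "\<dots> \<longleftrightarrow> of_int (m * c) \<le> r * u" by (simp add: rc mult_ac)
      finally show ?thesis by (simp add: le_floor_iff)
    qed
    then show ?thesis using fl by simp
  next
    case b: False
    then have "b < 0" using False by simp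
    then have "c < 0" using c r(1) by (metis mult_neg_pos mult_zero_right not_less_iff_gr_or_eq of_nat_0_less_iff)
    have "m \<le> u * b \<longleftrightarrow> \<lceil>r * u\<rceil> \<le> m * c" for u :: real
    proof -
      have "m \<le> u * b \<longleftrightarrow> of_int c * (u * b) \<le> of_int c * m"
        using \<open>c < 0\<close> by simp
      also have "\<dots> \<longleftrightarrow> r * u \<le> of_int (m * c)" by (simp add: rc mult_ac)
      finally show ?thesis by (simp add: ceiling_le_iff)
    qed
    then show ?thesis using ce \<open>b < 0\<close> by simp
  qed
qed auto

lemma codenominator_pos:
  fixes P :: "(real ^ 'n) set"
  assumes "rational_polytope P" "aff_dim P = int CARD('n)"
  shows "codenominator P > 0"
proof -
  have "finite (halfspace_description P)"
    using halfspace_description_irredundant[OF assms] by (simp add: irredundant_description_def)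
  then have "Lcm (snd ` halfspace_description P - {0}) \<noteq> 0"
    by (simp add: Lcm_0_iff)
  then show ?thesis
    unfolding codenominator_def using Lcm_int_greater_eq_0[of "snd ` halfspace_description P - {0}"] by linarith
qed

text \<open>
  The parts of the corollary for \<open>round_mid\<close> and for \<open>0 \<in> P\<close> are instances of this comparison.
  Equal floors and ceilings of \<open>r t\<close> mean that two parameters are equal or lie in the same open
  interval between multiples of \<open>1/r\<close>; if \<open>0 \<in> P\<close>, all right sides are nonnegative
  and equal floors suffice.
\<close>

lemma ehr_real_eq_ehr_rat:
  fixes P :: "(real ^ 'n) set"
  assumes rat: "rational_polytope P" and dim: "aff_dim P = int CARD('n)"
    and r: "r = codenominator P" and t: "t \<ge> 0" and q: "q \<ge> 0"
    and fl: "\<lfloor>r * of_rat q\<rfloor> = \<lfloor>r * t\<rfloor>" and ce: "0 \<in> P \<or> \<lceil>r * of_rat q\<rceil> = \<lceil>r * t\<rceil>"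
  shows "ehr_real P t = ehr_rat P q"
proof -
  define H where "H = halfspace_description P"
  have irr: "irredundant_description P H"
    unfolding H_def by (rule halfspace_description_irredundant[OF rat dim])
  then have fin: "finite H" and P: "P = solution_set H"
    by (auto simp: irredundant_description_def)
  have ne: "P \<noteq> {}" using dim by auto
  have bdd: "bounded P"
    using rat by (auto simp: rational_polytope_def polytope_def intro!: polytope_imp_bounded)
  have rH: "int r = Lcm (snd ` H - {0})" by (simp add: r codenominator_def H_def)
  have r0: "r > 0"
    using codenominator_pos[OF rat dim] r by simp
  have dv: "b = 0 \<or> b dvd int r" if "(a, b) \<in> H" for a b
    using that unfolding rH by (force intro!: dvd_Lcm)
  have b0: "b \<ge> 0" if "(a, b) \<in> H" "0 \<in> P" for a b
    using that unfolding P solution_set_def by force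
  have key: "real_vec a \<bullet> x \<le> of_rat q * of_int b \<longleftrightarrow> real_vec a \<bullet> x \<le> t * of_int b"
    if "(a, b) \<in> H" "x \<in> integer_points" for a b x
  proof -
    have "real_vec a \<bullet> x \<in> \<int>"
      using that(2) by (auto simp: inner_vec_def integer_points_def)
    then obtain m where "real_vec a \<bullet> x = of_int m" by (auto elim: Ints_cases)
    then show ?thesis
      using integer_inequality_cell[OF r0 dv[OF that(1)] fl, of m] b0[OF that(1)] ce by auto
  qed
  have dil: "(\<lambda>x. u *\<^sub>R x) ` P = {x. \<forall>(a, b) \<in> H. real_vec a \<bullet> x \<le> u * real_of_int b}" if "u \<ge> 0" for u
    using dilate_solution_set[of H u] bdd ne that unfolding P by blast
  have "(\<lambda>x. t *\<^sub>R x) ` P \<inter> integer_points = (\<lambda>x. real_of_rat q *\<^sub>R x) ` P \<inter> integer_points"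
  proof (rule set_eqI)
    fix x
    have "x \<in> (\<lambda>x. t *\<^sub>R x) ` P \<longleftrightarrow> x \<in> (\<lambda>x. real_of_rat q *\<^sub>R x) ` P"
      if "x \<in> integer_points"
    proof -
      have q': "real_of_rat q \<ge> 0" using q by simp
      show ?thesis
        unfolding dil[OF t] dil[OF q'] using key[OF _ that] by fast
    qed
    then show "x \<in> (\<lambda>x. t *\<^sub>R x) ` P \<inter> integer_points \<longleftrightarrow>
        x \<in> (\<lambda>x. real_of_rat q *\<^sub>R x) ` P \<inter> integer_points" by blast
  qed
  then show ?thesis by (simp add: ehr_real_def ehr_rat_def)
qed

text \<open>
  The interval of radius \<open>1/(2r)\<close> around \<open>(2j + 1)/(2r)\<close> is the open interval from \<open>j/r\<close> to
  \<open>(j + 1)/r\<close>, so \<open>j = \<lfloor>r t\<rfloor>\<close>.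
\<close>

lemma round_mid_eq:
  assumes "r > 0" "r * t \<notin> \<int>"
  shows "round_mid r t = of_int (2 * \<lfloor>r * t\<rfloor> + 1) / of_nat (2 * r)"
proof -
  have iff: "\<bar>t - real_of_int (2 * j + 1) / real (2 * r)\<bar> < 1 / real (2 * r) \<longleftrightarrow> j = \<lfloor>r * t\<rfloor>" for j
  proof -
    have "\<bar>t - real_of_int (2 * j + 1) / real (2 * r)\<bar> = \<bar>2 * (r * t) - (2 * j + 1)\<bar> / (2 * r)"
      using assms(1) by (simp add: field_simps abs_if)
    also have "\<dots> < 1 / real (2 * r) \<longleftrightarrow> \<bar>2 * (r * t) - (2 * j + 1)\<bar> < 1"
      using assms(1) by (simp add: divide_less_cancel)
    also have "\<dots> \<longleftrightarrow> j < r * t \<and> r * t < j + 1" by linarith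
    also have "\<dots> \<longleftrightarrow> j = \<lfloor>r * t\<rfloor>"
      using assms(2) by (metis Ints_of_int floor_unique floor_correct less_le of_int_add of_int_1)
    finally show ?thesis .
  qed
  show ?thesis unfolding round_mid_def iff by simp
qed

theorem corollary5:
  fixes P :: "(real ^ 'n) set" and r :: nat and t :: real
  assumes "rational_polytope P"
    and "aff_dim P = int CARD('n)"
    and "r = codenominator P"
    and "t \<ge> 0"
  shows "(\<forall>k :: nat. t = real k / real r \<longrightarrow>
            ehr_real P t = ehr_rat P (of_nat k / of_nat r)) \<and>
         (t \<notin> {real k / real r |k :: nat. True} \<longrightarrow>
            ehr_real P t = ehr_rat P (round_mid r t)) \<and>
         (0 \<in> P \<longrightarrow>
            ehr_real P t = ehr_rat P (of_int \<lfloor>real r * t\<rfloor> / of_nat r))"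
proof (intro conjI allI impI)
  note transfer = ehr_real_eq_ehr_rat[OF assms(1-3)]
  have r: "r > 0" using codenominator_pos[OF assms(1,2)] assms(3) by simp
  have j0: "\<lfloor>r * t\<rfloor> \<ge> 0" using assms(4) by simp
  show "ehr_real P t = ehr_rat P (of_nat k / of_nat r)" if "t = real k / real r" for k
    by (simp add: ehr_real_def ehr_rat_def that of_rat_divide)
  show "ehr_real P t = ehr_rat P (of_int \<lfloor>real r * t\<rfloor> / of_nat r)" if "0 \<in> P"
    by (rule transfer) (use assms(4) r j0 that in \<open>simp_all add: of_rat_divide\<close>)
  show "ehr_real P t = ehr_rat P (round_mid r t)" if "t \<notin> {real k / real r |k :: nat. True}"
  proof -
    define j where "j = \<lfloor>r * t\<rfloor>"
    have nint: "r * t \<notin> \<int>"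
    proof
      assume "r * t \<in> \<int>"
      then have "t = real (nat j) / real r"
        using r j0 by (auto simp: j_def field_simps elim!: Ints_cases)
      then show False using that by blast
    qed
    have mid: "round_mid r t = of_int (2 * j + 1) / of_nat (2 * r)"
      unfolding j_def by (rule round_mid_eq[OF r nint])
    have "r * real_of_rat (round_mid r t) = j + 1 / 2"
      using r by (simp add: mid of_rat_divide of_rat_add of_rat_mult field_simps)
    moreover have "\<lfloor>j + 1 / 2 :: real\<rfloor> = j" "\<lceil>j + 1 / 2 :: real\<rceil> = j + 1" by linarith+
    moreover have "\<lceil>r * t\<rceil> = j + 1"
      using nint by (simp add: j_def ceiling_altdef) (metis Ints_of_int)
    moreover have "round_mid r t \<ge> 0" using j0 by (simp add: mid j_def)
    ultimately show ?thesis
      using transfer[of t "round_mid r t"] assms(4) j_def by simp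
  qed
qed

end
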